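(* Let $\chi=\{(E_c\cdot\mathcal A\cdot e^{\mathrm j\Phi})_{c\in\mathcal I}\in\mathcal H:\Phi\in\mathbb R^{n\times n}\}$. For any $x=(x_c)_{c\in\mathcal I}\in\mathcal H$, $$P_\chi(x)=\Big\{(E_c\cdot\mathcal A\cdot e^{\mathrm j\Psi})_{c\in\mathcal I}\ :\ \Psi\in\arg\Big(\sum_{c\in\mathcal I}(E_c\cdot\mathcal A\cdot x_c)\Big)\Big\}.$$
   Context: Let $n\ge1$ be an integer. Products, exponentials, equalities and arguments of $n\times n$ arrays are elementwise; $\mathrm j=\sqrt{-1}$; indices are $\xi=(\xi_1,\xi_2)$, $1\le\xi_1,\xi_2\le n$, and $w[\xi]$ is the entry of $w$ at $\xi$. The argument is set-valued: for $w\in\mathbb C^{n\times n}$, $\Psi\in\arg(w)$ means $\Psi\in\mathbb R^{n\times n}$ and $w=|w|\cdot e^{\mathrm j\Psi}$ elementwise (so $\Psi[\xi]$ is an arbitrary real number where $w[\xi]=0$). Let $\mathcal I=\{XX,XY,XZ,YX,YY,YZ\}$ and $\mathcal H=(\mathbb C^{n\times n})^6$, with elements $x=(x_c)_{c\in\mathcal I}$, with Frobenius norm $\|x\|^2=\sum_{c\in\mathcal I}\sum_\xi|x_c[\xi]|^2$. For $\Omega\subset\mathcal H$, $P_\Omega(x)=\{w\in\Omega:\|x-w\|=\inf_{v\in\Omega}\|x-v\|\}$. $\mathcal A\in\mathbb R_+^{n\times n}$ is a given entrywise nonnegative matrix (the known amplitude of the generalized pupil function). The matrices $E_c$: for every index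 $\xi$ (sampling point of the lens aperture) let $(k_X,k_Y,k_Z)=(k_X[\xi],k_Y[\xi],k_Z[\xi])\in\mathbb R^3$ be a unit vector (the unit wave vector) with $1+k_Z\neq0$. The real $n\times n$ matrices $E_c$ are given entrywise by $E_{XX}=1-\frac{k_X^2}{1+k_Z}$, $E_{XY}=E_{YX}=-\frac{k_Xk_Y}{1+k_Z}$, $E_{YY}=1-\frac{k_Y^2}{1+k_Z}$, $E_{XZ}=-k_X$, $E_{YZ}=-k_Y$; they satisfy $\sum_{c\in\mathcal I}E_c^2=2$ in every entry. *)

theory Defs
  imports "HOL-Analysis.Analysis"
begin

datatype channel = XX | XY | XZ | YX | YY | YZ

lemma UNIV_channel: "(UNIV :: channel set) = {XX, XY, XZ, YX, YY, YZ}"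
  using channel.exhaust by auto

instance channel :: finite
  by standard (simp add: UNIV_channel)

(* The size n of the arrays is CARD('n). The Hilbert space is
   complex ^ 'n ^ 'n ^ channel: nested L2 norms make the library's norm on this type
   the Frobenius norm, and (w $ c) $ i $ j is the entry of channel c at (i, j). *)

definition proj :: "'a::real_normed_vector set \<Rightarrow> 'a \<Rightarrow> 'a set" where
  "proj \<Omega> x = {w \<in> \<Omega>. norm (x - w) = (INF v\<in>\<Omega>. norm (x - v))}"

(* Set-valued argument: unconstrained where the entry of w is 0. *)
definition args :: "complex ^ 'n ^ 'n \<Rightarrow> (real ^ 'n ^ 'n) set" where
  "args w = {\<Psi>. \<forall>i j. w $ i $ j =
     complex_of_real (cmod (w $ i $ j)) * exp (\<i> * complex_of_real (\<Psi> $ i $ j))}"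

(* q = (k_X, k_Y, k_Z) is the wave vector at one sampling point. *)
fun E_entry :: "channel \<Rightarrow> real ^ 3 \<Rightarrow> real" where
  "E_entry XX q = 1 - (q $ 1)\<^sup>2 / (1 + q $ 3)"
| "E_entry XY q = - (q $ 1 * q $ 2) / (1 + q $ 3)"
| "E_entry XZ q = - (q $ 1)"
| "E_entry YX q = - (q $ 1 * q $ 2) / (1 + q $ 3)"
| "E_entry YY q = 1 - (q $ 2)\<^sup>2 / (1 + q $ 3)"
| "E_entry YZ q = - (q $ 2)"

definition E :: "real ^ 3 ^ 'n ^ 'n \<Rightarrow> channel \<Rightarrow> real ^ 'n ^ 'n" where
  "E k c = (\<chi> i j. E_entry c (k $ i $ j))"

definition pupil_field ::
    "real ^ 3 ^ 'n ^ 'n \<Rightarrow> real ^ 'n ^ 'n \<Rightarrow> real ^ 'n ^ 'n \<Rightarrow> complex ^ 'n ^ 'n ^ channel" where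
  "pupil_field k A \<Phi> = (\<chi> c i j. complex_of_real (E k c $ i $ j) *
     complex_of_real (A $ i $ j) * exp (\<i> * complex_of_real (\<Phi> $ i $ j)))"

definition chi_set :: "real ^ 3 ^ 'n ^ 'n \<Rightarrow> real ^ 'n ^ 'n \<Rightarrow> (complex ^ 'n ^ 'n ^ channel) set" where
  "chi_set k A = {pupil_field k A \<Phi> | \<Phi>. True}"

definition weighted_sum ::
    "real ^ 3 ^ 'n ^ 'n \<Rightarrow> real ^ 'n ^ 'n \<Rightarrow> complex ^ 'n ^ 'n ^ channel \<Rightarrow> complex ^ 'n ^ 'n" where
  "weighted_sum k A x = (\<chi> i j. \<Sum>c\<in>UNIV. complex_of_real (E k c $ i $ j) *
     complex_of_real (A $ i $ j) * x $ c $ i $ j)"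

end

theory Submission
  imports Defs
begin

text \<open>
  All channels share the phase \<open>\<Phi>\<close> and have real weights, so expanding the square merges their
  cross terms: the squared distance from \<open>x\<close> to \<open>pupil_field k A \<Phi>\<close> depends on \<open>\<Phi>\<close> only
  through the real parts of \<open>cnj (exp (\<i> * \<Phi>)) * s\<close>, one for each entry \<open>s\<close> of the weighted
  sum. The quadratic terms are free of the phase; they are explicit because the squared entries
  of \<open>E k c\<close> sum to \<open>2\<close> over the channels.

  Each real part is at most \<open>cmod s\<close>, with equality exactly when \<open>\<Phi>\<close> is an argument of \<open>s\<close>
  (any number if \<open>s = 0\<close>). The shortfall is the \<open>misalignment\<close> below. The squared distance is
  therefore a constant plus twice the sum of the misalignments
  (\<open>norm_sq_minus_pupil_field\<close>). This sum is nonnegative, and it vanishes exactly on \<open>args\<close> of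
  the weighted sum, which is never empty: so the minimum is attained, and only there.
\<close>

definition misalignment :: "complex \<Rightarrow> real \<Rightarrow> real" where
  "misalignment s \<phi> = cmod s - Re (cnj (exp (\<i> * complex_of_real \<phi>)) * s)"

lemma misalignment_nonneg: "misalignment s \<phi> \<ge> 0"
  using complex_Re_le_cmod[of "cnj (exp (\<i> * complex_of_real \<phi>)) * s"]
  by (simp add: misalignment_def norm_mult)

text \<open>
  The equality case of \<open>Re z \<le> cmod z\<close>: a number whose real part equals its modulus is that
  modulus, and multiplying by the unimodular \<open>exp (\<i> * \<phi>)\<close> undoes the conjugate phase.
\<close>

lemma misalignment_eq_0_iff:
  "misalignment s \<phi> = 0 \<longleftrightarrow>
     s = complex_of_real (cmod s) * exp (\<i> * complex_of_real \<phi>)"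
proof -
  define e where "e = exp (\<i> * complex_of_real \<phi>)"
  have unimodular: "e * cnj e = 1"
    unfolding complex_norm_square[symmetric] by (simp add: e_def)
  have "misalignment s \<phi> = 0 \<longleftrightarrow> Re (cnj e * s) = cmod (cnj e * s)"
    by (auto simp: misalignment_def e_def norm_mult)
  also have "\<dots> \<longleftrightarrow> cnj e * s = complex_of_real (cmod (cnj e * s))"
    using cmod_power2[of "cnj e * s"] by (auto simp: complex_eq_iff)
  also have "\<dots> \<longleftrightarrow> cnj e * s = complex_of_real (cmod s)"
    by (simp add: e_def norm_mult)
  also have "\<dots> \<longleftrightarrow> s = complex_of_real (cmod s) * e"
    using unimodular by (metis mult.assoc mult.commute mult_1)
  finally show ?thesis
    by (simp add: e_def)
qed

lemma misalignment_Arg: "misalignment s (Arg s) = 0"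
proof (cases "s = 0")
  case False
  then show ?thesis
    unfolding misalignment_eq_0_iff by (rule Arg_eq)
qed (simp add: misalignment_def)

lemma args_iff_misalignment:
  "\<Psi> \<in> args w \<longleftrightarrow> (\<forall>i j. misalignment (w $ i $ j) (\<Psi> $ i $ j) = 0)"
  by (simp add: args_def misalignment_eq_0_iff)

lemma args_nonempty: "\<exists>\<Psi>. \<Psi> \<in> args w"
  by (rule exI[of _ "\<chi> i j. Arg (w $ i $ j)"])
    (simp add: args_iff_misalignment misalignment_Arg)

text \<open>
  With \<open>r = q\<^sub>X\<^sup>2 + q\<^sub>Y\<^sup>2\<close> and \<open>u = 1 + q\<^sub>Z\<close>, the sum is
  \<open>2 - 2 * (r / u) + (r / u)\<^sup>2 + r\<close>. For a unit vector \<open>r = u * (2 - u)\<close>, which clears the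
  denominators.
\<close>

lemma sum_E_entry_squared:
  assumes "norm q = 1" and "1 + q $ 3 \<noteq> 0"
  shows "(\<Sum>c\<in>UNIV. (E_entry c q)\<^sup>2) = 2"
proof -
  define a b u where "a = q $ 1" and "b = q $ 2" and "u = 1 + q $ 3"
  have u: "u \<noteq> 0" and q3: "q $ 3 = u - 1"
    using assms(2) by (auto simp: u_def)
  have "(q $ 1)\<^sup>2 + (q $ 2)\<^sup>2 + (q $ 3)\<^sup>2 = 1"
    using assms(1) by (simp add: norm_vec_def L2_set_def sum_3)
  then have ab: "a\<^sup>2 + b\<^sup>2 = u * (2 - u)"
    by (simp add: a_def b_def q3 power2_eq_square algebra_simps)
  have "(\<Sum>c\<in>UNIV. (E_entry c q)\<^sup>2) =
      (1 - a\<^sup>2 / u)\<^sup>2 + 2 * (a * b / u)\<^sup>2 + (1 - b\<^sup>2 / u)\<^sup>2 + (a\<^sup>2 + b\<^sup>2)"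
    by (simp add: UNIV_channel a_def b_def u_def)
  also have "\<dots> = 2 - 2 * ((a\<^sup>2 + b\<^sup>2) / u) + ((a\<^sup>2 + b\<^sup>2) / u)\<^sup>2 + (a\<^sup>2 + b\<^sup>2)"
    by (simp add: power2_eq_square add_divide_distrib algebra_simps)
  also have "\<dots> = 2"
  proof -
    have "(a\<^sup>2 + b\<^sup>2) / u = 2 - u"
      using u by (simp add: ab)
    then show ?thesis
      by (simp only: ab) (simp add: power2_eq_square algebra_simps)
  qed
  finally show ?thesis .
qed

lemma norm_sq_vec: "(norm v)\<^sup>2 = (\<Sum>i\<in>UNIV. (norm (v $ i))\<^sup>2)"
  for v :: "'a::real_normed_vector ^ 'm"
  by (simp add: norm_vec_def L2_set_def sum_nonneg)

lemma cmod_diff_sq: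
  "(cmod (z - w))\<^sup>2 = (cmod z)\<^sup>2 + (cmod w)\<^sup>2 - 2 * Re (cnj w * z)"
  unfolding cmod_power2 by (simp add: power2_eq_square algebra_simps)

text \<open>
  The contribution of one sampling point. Real weights \<open>f c\<close> pass through \<open>Re\<close> and \<open>cnj\<close>, so the
  cross terms of all channels merge into one, that of the weighted sum.
\<close>

lemma sum_cmod_sq_common_phase:
  fixes f :: "'c \<Rightarrow> real" and y :: "'c \<Rightarrow> complex" and a \<phi> :: real and I :: "'c set"
  defines "s \<equiv> \<Sum>c\<in>I. complex_of_real (f c) * complex_of_real a * y c"
  shows "(\<Sum>c\<in>I. (cmod (y c - complex_of_real (f c) * complex_of_real a *
             exp (\<i> * complex_of_real \<phi>)))\<^sup>2) =
      (\<Sum>c\<in>I. (cmod (y c))\<^sup>2) + a\<^sup>2 * (\<Sum>c\<in>I. (f c)\<^sup>2) - 2 * cmod s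
      + 2 * misalignment s \<phi>"
proof -
  define e where "e = exp (\<i> * complex_of_real \<phi>)"
  have cross: "(\<Sum>c\<in>I. Re (cnj (of_real (f c) * of_real a * e) * y c)) = Re (cnj e * s)"
    unfolding s_def Re_sum[symmetric] sum_distrib_left
    by (simp add: mult_ac)
  have "(\<Sum>c\<in>I. (cmod (y c - of_real (f c) * of_real a * e))\<^sup>2) =
      (\<Sum>c\<in>I. (cmod (y c))\<^sup>2 + a\<^sup>2 * (f c)\<^sup>2
         - 2 * Re (cnj (of_real (f c) * of_real a * e) * y c))"
    by (simp only: cmod_diff_sq) (simp add: e_def norm_mult power_mult_distrib mult_ac)
  also have "\<dots> = (\<Sum>c\<in>I. (cmod (y c))\<^sup>2) + a\<^sup>2 * (\<Sum>c\<in>I. (f c)\<^sup>2) - 2 * Re (cnj e * s)"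
    by (simp only: sum.distrib sum_subtractf sum_distrib_left[symmetric] cross)
  finally show ?thesis
    by (simp add: misalignment_def e_def)
qed

lemma norm_sq_minus_pupil_field:
  fixes k :: "real ^ 3 ^ 'n ^ 'n"
  assumes "\<And>i j. norm (k $ i $ j) = 1" and "\<And>i j. 1 + k $ i $ j $ 3 \<noteq> 0"
  shows "(norm (x - pupil_field k A \<Phi>))\<^sup>2 =
    (\<Sum>i\<in>UNIV. \<Sum>j\<in>UNIV. (\<Sum>c\<in>UNIV. (cmod (x $ c $ i $ j))\<^sup>2) + 2 * (A $ i $ j)\<^sup>2
        - 2 * cmod (weighted_sum k A x $ i $ j))
    + 2 * (\<Sum>i\<in>UNIV. \<Sum>j\<in>UNIV. misalignment (weighted_sum k A x $ i $ j) (\<Phi> $ i $ j))"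
proof -
  have "(norm (x - pupil_field k A \<Phi>))\<^sup>2 =
      (\<Sum>c\<in>UNIV. \<Sum>i\<in>UNIV. \<Sum>j\<in>UNIV. (cmod (x $ c $ i $ j - pupil_field k A \<Phi> $ c $ i $ j))\<^sup>2)"
    by (simp add: norm_sq_vec)
  also have "\<dots> =
      (\<Sum>i\<in>UNIV. \<Sum>c\<in>UNIV. \<Sum>j\<in>UNIV. (cmod (x $ c $ i $ j - pupil_field k A \<Phi> $ c $ i $ j))\<^sup>2)"
    by (rule sum.swap)
  also have "\<dots> =
      (\<Sum>i\<in>UNIV. \<Sum>j\<in>UNIV. \<Sum>c\<in>UNIV. (cmod (x $ c $ i $ j - pupil_field k A \<Phi> $ c $ i $ j))\<^sup>2)"
    by (intro sum.cong refl sum.swap)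
  also have "\<dots> = (\<Sum>i\<in>UNIV. \<Sum>j\<in>UNIV.
      (\<Sum>c\<in>UNIV. (cmod (x $ c $ i $ j))\<^sup>2) + 2 * (A $ i $ j)\<^sup>2
        - 2 * cmod (weighted_sum k A x $ i $ j)
        + 2 * misalignment (weighted_sum k A x $ i $ j) (\<Phi> $ i $ j))"
    by (intro sum.cong refl)
      (simp add: pupil_field_def weighted_sum_def E_def sum_cmod_sq_common_phase
        sum_E_entry_squared[OF assms])
  finally show ?thesis
    by (simp add: sum.distrib sum_distrib_left)
qed

lemma mem_proj_iff: "w \<in> proj \<Omega> x \<longleftrightarrow> w \<in> \<Omega> \<and> (\<forall>v\<in>\<Omega>. norm (x - w) \<le> norm (x - v))"
proof -
  have bdd: "bdd_below ((\<lambda>v. norm (x - v)) ` \<Omega>)"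
    by (rule bdd_belowI2[of _ 0]) simp
  have "norm (x - w) = (INF v\<in>\<Omega>. norm (x - v)) \<longleftrightarrow> (\<forall>v\<in>\<Omega>. norm (x - w) \<le> norm (x - v))"
    if "w \<in> \<Omega>"
    using that bdd by (auto intro!: antisym cINF_greatest cINF_lower)
  then show ?thesis
    by (auto simp: proj_def)
qed

theorem lemma3p7:
  fixes k :: "real ^ 3 ^ 'n ^ 'n"
    and A :: "real ^ 'n ^ 'n"
    and x :: "complex ^ 'n ^ 'n ^ channel"
  assumes unit: "\<And>i j. norm (k $ i $ j) = 1"
    and kZ: "\<And>i j. 1 + k $ i $ j $ 3 \<noteq> 0"
    and A_nonneg: "\<And>i j. A $ i $ j \<ge> 0"
  shows "proj (chi_set k A) x = {pupil_field k A \<Psi> | \<Psi>. \<Psi> \<in> args (weighted_sum k A x)}"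
proof -
  define D where "D \<Phi> =
    (\<Sum>i\<in>UNIV. \<Sum>j\<in>UNIV. misalignment (weighted_sum k A x $ i $ j) (\<Phi> $ i $ j))"
    for \<Phi> :: "real ^ 'n ^ 'n"
  have D_nonneg: "D \<Phi> \<ge> 0" for \<Phi>
    by (simp add: D_def sum_nonneg misalignment_nonneg)
  have D_eq_0_iff: "D \<Phi> = 0 \<longleftrightarrow> \<Phi> \<in> args (weighted_sum k A x)" for \<Phi>
    by (simp add: D_def args_iff_misalignment sum_nonneg_eq_0_iff sum_nonneg
        misalignment_nonneg)
  obtain \<Psi>\<^sub>0 where "D \<Psi>\<^sub>0 = 0"
    using args_nonempty D_eq_0_iff by blast
  have dist_le_iff: "norm (x - pupil_field k A \<Phi>) \<le> norm (x - pupil_field k A \<Psi>) \<longleftrightarrow> D \<Phi> \<le> D \<Psi>"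
    for \<Phi> \<Psi>
    by (subst abs_norm_cancel[symmetric], subst (2) abs_norm_cancel[symmetric],
        subst abs_le_square_iff)
      (simp add: norm_sq_minus_pupil_field[OF unit kZ] D_def)
  have range: "chi_set k A = range (pupil_field k A)"
    by (auto simp: chi_set_def)
  have "pupil_field k A \<Phi> \<in> proj (chi_set k A) x \<longleftrightarrow> \<Phi> \<in> args (weighted_sum k A x)" for \<Phi>
  proof -
    have "pupil_field k A \<Phi> \<in> proj (chi_set k A) x \<longleftrightarrow> (\<forall>\<Psi>. D \<Phi> \<le> D \<Psi>)"
      by (simp add: mem_proj_iff range dist_le_iff)
    also have "\<dots> \<longleftrightarrow> D \<Phi> = 0"
      using D_nonneg \<open>D \<Psi>\<^sub>0 = 0\<close> by (metis antisym)
    finally show ?thesis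
      by (simp add: D_eq_0_iff)
  qed
  moreover have "proj (chi_set k A) x \<subseteq> range (pupil_field k A)"
    by (auto simp: proj_def range)
  ultimately show ?thesis
    by blast
qed

end
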